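(* Let $R$ be a field, $\delta\in R$, with associated $\ell$ and $p$. Consider the matrices $(\tilde e_{n,m})$ and $(\tilde d_{n,m})$ with rows and columns indexed by positive integers $n,m$, where $\tilde d_{n,m}=1$ if $m-1\in\operatorname{supp}(n-1)$ and $\tilde d_{n,m}=0$ otherwise, and $\tilde e_{n,m}$ is defined by $$\tilde e_{n,m}=\begin{cases}0 & n\not\equiv m \pmod 2\\ -1 & \nu_{(p)}\left(\frac{n+m}{2}\right)>\nu_{(p)}(m)\ \text{and}\ m\triangleleft\frac{n+m}{2}-1\\ 1 & \nu_{(p)}\left(\frac{n+m}{2}\right)=\nu_{(p)}(m)\ \text{and}\ m\,\dot\triangleleft\,\frac{n+m}{2}\\ 0 & \text{otherwise.}\end{cases}$$ Then the matrix $(\tilde e_{n,m})$ is inverse to the matrix $(\tilde d_{n,m})$.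
   Context: Quantum numbers: $[0]=0$, $[1]=1$, $[k+1]=\delta[k]-[k-1]$ in $R$; $\ell$ is the least positive integer with $[\ell]=0$ in $R$ ($\ell=\infty$ if none); $p$ is the characteristic of $R$ ($p=\infty$ if it is $0$). Put $p^{(0)}=1$, $p^{(i)}=\ell p^{i-1}$ for $i\ge1$. The $(\ell,p)$-digits of $x\in\mathbb{N}$ are the $x_i$ in $x=\sum_i x_ip^{(i)}$ with $0\le x_0<\ell$, $0\le x_i<p$ for $i\ge1$ (only $x_0$ occurs if $\ell=\infty$; only $x_0,x_1$ if $p=\infty$). For $n\ge0$, writing $n+1=\sum_{i=0}^k n_ip^{(i)}$ with these digits and $n_k\ne0$, $\operatorname{supp}(n)=\{n_kp^{(k)}\pm n_{k-1}p^{(k-1)}\pm\cdots\pm n_0p^{(0)}-1\}$, over all choices of signs. Write $x\triangleright y$ (equivalently $y\triangleleft x$) if $x_i\ge y_i$ for all $i$. For $x\ge1$ let $\nu_{(p)}(x)=0$ if $\ell\nmid x$ and $\nu_{(p)}(x)=\nu_p(x/\ell)+1$ otherwise, with $\nu_p$ the $p$-adic valuation (identically $0$ if $p=\infty$). Write $x\,\dot\triangleright\,y$ (equivalently $y\,\dot\triangleleft\,x$) if $x\triangleright y$, $\nu_{(p)}(x)=\nu_{(p)}(y)$, and the $\nu_{(p)}(x)$-th digits of $x$ and $y$ agree. *)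

theory Defs
  imports Complex_Main "HOL-Library.Extended_Nat" "HOL-Computational_Algebra.Computational_Algebra"
begin

fun qnum :: "'a::comm_ring_1 \<Rightarrow> nat \<Rightarrow> 'a" where
  "qnum \<delta> 0 = 0"
| "qnum \<delta> (Suc 0) = 1"
| "qnum \<delta> (Suc (Suc k)) = \<delta> * qnum \<delta> (Suc k) - qnum \<delta> k"

definition qorder :: "'a::comm_ring_1 \<Rightarrow> enat" where
  "qorder \<delta> = (if \<exists>k>0. qnum \<delta> k = 0 then enat (LEAST k. k > 0 \<and> qnum \<delta> k = 0) else \<infinity>)"

definition echar :: "'a::comm_ring_1 itself \<Rightarrow> enat" where
  "echar _ = (if CHAR('a) = 0 then \<infinity> else enat CHAR('a))"

definition place :: "enat \<Rightarrow> enat \<Rightarrow> nat \<Rightarrow> enat" where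
  "place l p i = (if i = 0 then 1 else l * p ^ (i - 1))"

text \<open>The sum is taken in \<^typ>\<open>enat\<close>. As it has to equal the finite number \<open>x\<close>, all digits at
  infinite places vanish, so that only \<open>d 0\<close> can be nonzero if \<open>l = \<infinity>\<close>, and only \<open>d 0\<close> and \<open>d 1\<close>
  if \<open>p = \<infinity>\<close>. Existence and uniqueness are shown in \<open>is_digits_iff\<close> below.\<close>

definition is_digits :: "enat \<Rightarrow> enat \<Rightarrow> nat \<Rightarrow> (nat \<Rightarrow> nat) \<Rightarrow> bool" where
  "is_digits l p x d \<longleftrightarrow>
     enat (d 0) < l \<and> (\<forall>i\<ge>1. enat (d i) < p) \<and>
     finite {i. d i \<noteq> 0} \<and> enat x = (\<Sum>i | d i \<noteq> 0. enat (d i) * place l p i)"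

definition digits :: "enat \<Rightarrow> enat \<Rightarrow> nat \<Rightarrow> nat \<Rightarrow> nat" where
  "digits l p x = (THE d. is_digits l p x d)"

text \<open>Every place \<open>i \<le> k\<close> below is finite because the \<open>k\<close>-th digit is nonzero, so \<^const>\<open>the_enat\<close>
  is only applied to finite values.\<close>

definition supp :: "enat \<Rightarrow> enat \<Rightarrow> nat \<Rightarrow> int set" where
  "supp l p n =
     {int (digits l p (n + 1) k * the_enat (place l p k))
        + (\<Sum>i<k. s i * int (digits l p (n + 1) i * the_enat (place l p i))) - 1 | k s.
      digits l p (n + 1) k \<noteq> 0 \<and> (\<forall>i>k. digits l p (n + 1) i = 0) \<and> (\<forall>i<k. s i \<in> {1, -1})}"

definition dominates :: "enat \<Rightarrow> enat \<Rightarrow> nat \<Rightarrow> nat \<Rightarrow> bool" where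
  "dominates l p x y \<longleftrightarrow> (\<forall>i. digits l p x i \<ge> digits l p y i)"

definition nu :: "enat \<Rightarrow> enat \<Rightarrow> nat \<Rightarrow> nat" where
  "nu l p x =
     (case l of
        \<infinity> \<Rightarrow> 0
      | enat l' \<Rightarrow>
          if l' dvd x
          then (case p of \<infinity> \<Rightarrow> 0 | enat p' \<Rightarrow> multiplicity p' (x div l')) + 1
          else 0)"

definition dot_dominates :: "enat \<Rightarrow> enat \<Rightarrow> nat \<Rightarrow> nat \<Rightarrow> bool" where
  "dot_dominates l p x y \<longleftrightarrow>
     dominates l p x y \<and> nu l p x = nu l p y \<and>
     digits l p x (nu l p x) = digits l p y (nu l p x)"

definition dtilde :: "enat \<Rightarrow> enat \<Rightarrow> nat \<Rightarrow> nat \<Rightarrow> int" where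
  "dtilde l p n m = (if int (m - 1) \<in> supp l p (n - 1) then 1 else 0)"

definition etilde :: "enat \<Rightarrow> enat \<Rightarrow> nat \<Rightarrow> nat \<Rightarrow> int" where
  "etilde l p n m =
     (if n mod 2 \<noteq> m mod 2 then 0
      else if nu l p ((n + m) div 2) > nu l p m \<and> dominates l p ((n + m) div 2 - 1) m then -1
      else if nu l p ((n + m) div 2) = nu l p m \<and> dot_dominates l p ((n + m) div 2) m then 1
      else 0)"

text \<open>Infinite matrices with rows and columns indexed by the positive integers; the values at index
  \<open>0\<close> are irrelevant. A product exists only if each of the sums defining its entries has finitely
  many nonzero terms.\<close>

definition has_mat_prod ::
  "(nat \<Rightarrow> nat \<Rightarrow> 'b::comm_ring_1) \<Rightarrow> (nat \<Rightarrow> nat \<Rightarrow> 'b) \<Rightarrow> (nat \<Rightarrow> nat \<Rightarrow> 'b) \<Rightarrow> bool" where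
  "has_mat_prod A B C \<longleftrightarrow>
     (\<forall>n\<ge>1. \<forall>m\<ge>1. finite {k. k \<ge> 1 \<and> A n k * B k m \<noteq> 0} \<and>
        (\<Sum>k | k \<ge> 1 \<and> A n k * B k m \<noteq> 0. A n k * B k m) = C n m)"

definition mat_inverse :: "(nat \<Rightarrow> nat \<Rightarrow> 'b::comm_ring_1) \<Rightarrow> (nat \<Rightarrow> nat \<Rightarrow> 'b) \<Rightarrow> bool" where
  "mat_inverse A B \<longleftrightarrow>
     has_mat_prod A B (\<lambda>n m. if n = m then 1 else 0) \<and>
     has_mat_prod B A (\<lambda>n m. if n = m then 1 else 0)"


lemma base_digits_iff:
  fixes b x :: nat
  assumes b: "b \<ge> 2"
  shows "((\<forall>i. e i < b) \<and> (\<forall>i\<ge>N. e i = 0) \<and> x = (\<Sum>i<N. e i * b ^ i)) \<longleftrightarrow>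
         (x < b ^ N \<and> e = (\<lambda>i. x div b ^ i mod b))"
proof (induction N arbitrary: x e)
  case 0
  show ?case using b by (auto simp: fun_eq_iff)
next
  case (Suc N)
  have sum: "(\<Sum>i<Suc N. e i * b ^ i) = e 0 + b * (\<Sum>i<N. e (Suc i) * b ^ i)"
    unfolding sum.lessThan_Suc_shift by (simp add: sum_distrib_left algebra_simps)
  have split: "x = e 0 + b * y \<longleftrightarrow> e 0 = x mod b \<and> y = x div b" if "e 0 < b" for y
    using that b by auto
  have "((\<forall>i. e i < b) \<and> (\<forall>i\<ge>Suc N. e i = 0) \<and> x = (\<Sum>i<Suc N. e i * b ^ i)) \<longleftrightarrow>
        e 0 = x mod b \<and> ((\<forall>i. e (Suc i) < b) \<and> (\<forall>i\<ge>N. e (Suc i) = 0) \<and>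
           x div b = (\<Sum>i<N. e (Suc i) * b ^ i))" (is "?L \<longleftrightarrow> ?R")
  proof
    assume L: ?L
    have eb: "e i < b" for i using L by (rule conjunct1[THEN spec])
    have "e (Suc i) = 0" if "i \<ge> N" for i
      using L[THEN conjunct2, THEN conjunct1] that by simp
    moreover have "e 0 = x mod b \<and> x div b = (\<Sum>i<N. e (Suc i) * b ^ i)"
      using L[THEN conjunct2, THEN conjunct2, unfolded sum] split[OF eb] by (metis (no_types))
    ultimately show ?R using eb by simp
  next
    assume R: ?R
    have R1: "e 0 = x mod b" and R2: "e (Suc i) < b" and R3: "i \<ge> N \<Longrightarrow> e (Suc i) = 0"
      and R4: "x div b = (\<Sum>i<N. e (Suc i) * b ^ i)" for i
      using R by (simp_all only: simp_thms)
    have e0: "e 0 < b" unfolding R1 using b by simp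
    have "e i < b" for i using e0 R2 by (cases i) simp_all
    moreover have "e i = 0" if "i \<ge> Suc N" for i using R3 that by (cases i) simp_all
    moreover have "x = (\<Sum>i<Suc N. e i * b ^ i)"
      unfolding sum R4[symmetric] R1 by simp
    ultimately show ?L by simp
  qed
  also have "\<dots> \<longleftrightarrow> e 0 = x mod b \<and> x div b < b ^ N \<and> (\<lambda>i. e (Suc i)) = (\<lambda>i. x div b div b ^ i mod b)"
    using Suc[of "\<lambda>i. e (Suc i)" "x div b"] by simp
  also have "\<dots> \<longleftrightarrow> x < b ^ Suc N \<and> e = (\<lambda>i. x div b ^ i mod b)"
  proof -
    have "x div b < b ^ N \<longleftrightarrow> x < b ^ Suc N"
      using b by (simp add: div_less_iff_less_mult mult.commute)
    moreover have "e = (\<lambda>i. x div b ^ i mod b) \<longleftrightarrow>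
        e 0 = x mod b \<and> (\<lambda>i. e (Suc i)) = (\<lambda>i. x div b div b ^ i mod b)"
    proof -
      have "e i = x div b ^ i mod b"
        if "e 0 = x mod b" "(\<lambda>i. e (Suc i)) = (\<lambda>i. x div b div b ^ i mod b)" for i
        using that(1) fun_cong[OF that(2)] by (cases i) (simp_all add: div_mult2_eq)
      thus ?thesis by (auto simp: div_mult2_eq)
    qed
    ultimately show ?thesis by auto
  qed
  finally show ?case .
qed

lemma is_digits_iff:
  assumes l: "l \<ge> 2" and p: "p \<ge> 2"
  shows "is_digits l p x d \<longleftrightarrow> d =
    (case l of
       \<infinity> \<Rightarrow> (\<lambda>i. if i = 0 then x else 0)
     | enat l' \<Rightarrow> (case p of
           \<infinity> \<Rightarrow> (\<lambda>i. if i = 0 then x mod l' else if i = 1 then x div l' else 0)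
         | enat p' \<Rightarrow> (\<lambda>i. if i = 0 then x mod l' else x div l' div p' ^ (i - 1) mod p')))"
proof -
  have sum_on: "(\<Sum>i | d i \<noteq> 0. enat (d i) * place l p i) = (\<Sum>i\<in>A. enat (d i) * place l p i)"
    if "finite A" "\<And>i. i \<notin> A \<Longrightarrow> d i = 0" for A
  proof (rule sum.mono_neutral_left)
    show "finite A" by (rule that(1))
    show "{i. d i \<noteq> 0} \<subseteq> A"
    proof
      fix i assume "i \<in> {i. d i \<noteq> 0}"
      hence "d i \<noteq> 0" by simp
      thus "i \<in> A" using that(2)[of i] by metis
    qed
    show "\<forall>i\<in>A - {i. d i \<noteq> 0}. enat (d i) * place l p i = 0"
      by (simp flip: zero_enat_def)
  qed
  have fin_on: "finite {i. d i \<noteq> 0}" if "finite A" "\<And>i. i \<notin> A \<Longrightarrow> d i = 0" for A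
  proof (rule finite_subset[OF _ that(1)])
    show "{i. d i \<noteq> 0} \<subseteq> A"
    proof
      fix i assume "i \<in> {i. d i \<noteq> 0}"
      hence "d i \<noteq> 0" by simp
      thus "i \<in> A" using that(2)[of i] by metis
    qed
  qed
  have vanish: "d i = 0" if "is_digits l p x d" "place l p i = \<infinity>" for i
  proof (rule ccontr)
    assume i: "d i \<noteq> 0"
    have fin: "finite {i. d i \<noteq> 0}" and x: "enat x = (\<Sum>i | d i \<noteq> 0. enat (d i) * place l p i)"
      using that by (auto simp: is_digits_def)
    have "enat (d i) * place l p i \<le> enat x"
      unfolding x using fin i by (intro member_le_sum) auto
    thus False using i that by (simp add: imult_is_infinity zero_enat_def times_enat_def)
  qed
  have pl: "place l p i = \<infinity>" if "l = \<infinity>" "i \<ge> 1" for i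
  proof -
    have "p \<noteq> 0" using p by (auto simp: numeral_eq_enat zero_enat_def)
    hence "p ^ j \<noteq> 0" for j by (induction j) simp_all
    thus ?thesis using that by (simp add: place_def imult_is_infinity)
  qed
  have place0: "place l p 0 = 1" by (simp add: place_def)
  show ?thesis
  proof (cases l)
    case infinity
    show ?thesis (is "_ \<longleftrightarrow> d = ?e")
    proof
      assume D: "is_digits l p x d"
      have z: "d i = 0" if "i \<noteq> 0" for i using vanish[OF D pl[OF infinity, of i]] that by simp
      have "enat x = (\<Sum>i\<in>{0}. enat (d i) * place l p i)"
        using D sum_on[of "{0}"] z by (auto simp: is_digits_def)
      hence "x = d 0" by (simp add: place0)
      thus "d = ?e" using z by (auto simp: infinity fun_eq_iff)
    next
      assume d: "d = ?e"
      have z: "d i = 0" if "i \<noteq> 0" for i using that d by (simp add: infinity)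
      have d0: "d 0 = x" using d by (simp add: infinity)
      have "(\<Sum>i | d i \<noteq> 0. enat (d i) * place l p i) = (\<Sum>i\<in>{0}. enat (d i) * place l p i)"
        by (rule sum_on) (use z in auto)
      also have "\<dots> = enat x" by (simp add: place0 d0)
      finally have "(\<Sum>i | d i \<noteq> 0. enat (d i) * place l p i) = enat x" .
      moreover have "finite {i. d i \<noteq> 0}" by (rule fin_on[of "{0}"]) (use z in auto)
      moreover have "0 < p" using p by (cases p) (auto simp: numeral_eq_enat zero_enat_def)
      ultimately show "is_digits l p x d" using z by (auto simp: is_digits_def infinity enat_0)
    qed
  next
    case (enat L)
    have L: "L \<ge> 2" using l by (simp add: enat numeral_eq_enat)
    show ?thesis
    proof (cases p)
      case infinity
      have pl2: "place l p i = \<infinity>" if "i \<ge> 2" for i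
      proof -
        have "p ^ Suc j = \<infinity>" for j by (induction j) (simp_all add: infinity imult_is_infinity)
        moreover have "i - 1 = Suc (i - 2)" using that by simp
        ultimately have "p ^ (i - 1) = \<infinity>" by metis
        thus ?thesis using that L by (simp add: place_def enat times_enat_def zero_enat_def)
      qed
      have s01: "(\<Sum>i\<in>{0,1}. enat (d i) * place l p i) = enat (d 0 + L * d 1)"
        by (simp add: place_def enat mult.commute)
      have arith: "x = d 0 + L * y \<longleftrightarrow> d 0 = x mod L \<and> y = x div L" if "d 0 < L" for y
        using that by auto
      show ?thesis (is "_ \<longleftrightarrow> d = ?e")
      proof
        assume D: "is_digits l p x d"
        have z: "d i = 0" if "i \<ge> 2" for i using vanish[OF D pl2[OF that]] .
        have "i \<notin> {0,1} \<Longrightarrow> d i = 0" for i using z[of i] by simp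
        hence "enat x = (\<Sum>i\<in>{0,1}. enat (d i) * place l p i)"
          using D sum_on[of "{0,1}"] by (auto simp: is_digits_def)
        hence "x = d 0 + L * d 1" unfolding s01 by simp
        moreover have "d 0 < L" using D by (simp add: is_digits_def enat)
        ultimately have "d 0 = x mod L" "d 1 = x div L" using arith by blast+
        thus "d = ?e" using z by (auto simp: infinity enat fun_eq_iff)
      next
        assume d: "d = ?e"
        have z: "d i = 0" if "i \<notin> {0,1}" for i using that d by (simp add: infinity enat)
        have d01: "d 0 = x mod L" "d 1 = x div L" using d by (simp_all add: infinity enat)
        have "(\<Sum>i | d i \<noteq> 0. enat (d i) * place l p i) = (\<Sum>i\<in>{0,1}. enat (d i) * place l p i)"
          by (rule sum_on) (use z in auto)
        also have "\<dots> = enat x" unfolding s01 d01 by simp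
        finally have "(\<Sum>i | d i \<noteq> 0. enat (d i) * place l p i) = enat x" .
        moreover have "finite {i. d i \<noteq> 0}" by (rule fin_on[of "{0,1}"]) (use z in auto)
        ultimately show "is_digits l p x d" using L d01 by (auto simp: is_digits_def infinity enat)
      qed
    next
      case (enat P)
      note lL = \<open>l = enat L\<close>
      have P: "P \<ge> 2" using p by (simp add: enat numeral_eq_enat)
      have pw: "enat P ^ i = enat (P ^ i)" for i
        by (induction i) (simp_all add: one_enat_def)
      have sN: "(\<Sum>i<Suc N. enat (d i) * place l p i) =
          enat (d 0 + L * (\<Sum>i<N. d (Suc i) * P ^ i))" for N
      proof -
        have "enat (d i) * place l p i = enat (d i * (if i = 0 then 1 else L * P ^ (i - 1)))" for i
          by (auto simp: place_def lL enat pw one_enat_def)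
        hence "(\<Sum>i<Suc N. enat (d i) * place l p i) =
            enat (\<Sum>i<Suc N. d i * (if i = 0 then 1 else L * P ^ (i - 1)))"
          by (simp only: of_nat_eq_enat[symmetric] of_nat_sum)
        also have "(\<Sum>i<Suc N. d i * (if i = 0 then 1 else L * P ^ (i - 1))) =
            d 0 + L * (\<Sum>i<N. d (Suc i) * P ^ i)"
          unfolding sum.lessThan_Suc_shift by (simp add: sum_distrib_left algebra_simps)
        finally show ?thesis .
      qed
      have arith: "x = d 0 + L * y \<longleftrightarrow> d 0 = x mod L \<and> y = x div L" if "d 0 < L" for y
        using that by auto
      show ?thesis (is "_ \<longleftrightarrow> d = ?e")
      proof
        assume D: "is_digits l p x d"
        hence "finite {i. d i \<noteq> 0}" by (simp add: is_digits_def)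
        then obtain N where N: "\<And>i. d i \<noteq> 0 \<Longrightarrow> i < N"
          using finite_nat_set_iff_bounded by auto
        have z: "d i = 0" if "i \<notin> {..<Suc N}" for i using N[of i] that by force
        have "enat x = (\<Sum>i<Suc N. enat (d i) * place l p i)"
          using D sum_on[of "{..<Suc N}"] z by (auto simp: is_digits_def simp del: sum.lessThan_Suc)
        hence "x = d 0 + L * (\<Sum>i<N. d (Suc i) * P ^ i)" unfolding sN by simp
        moreover have "d 0 < L" using D by (simp add: is_digits_def lL)
        ultimately have x: "d 0 = x mod L" "x div L = (\<Sum>i<N. d (Suc i) * P ^ i)"
          using arith by metis+
        have "\<forall>i. d (Suc i) < P" using D by (simp add: is_digits_def enat)
        moreover have "\<forall>i\<ge>N. d (Suc i) = 0" using z by simp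
        ultimately have "(\<lambda>i. d (Suc i)) = (\<lambda>i. x div L div P ^ i mod P)"
          using base_digits_iff[OF P, of "\<lambda>i. d (Suc i)" N "x div L"] x(2) by blast
        hence S: "d (Suc i) = x div L div P ^ i mod P" for i by meson
        show "d = ?e"
        proof
          fix i show "d i = ?e i" using x(1) S by (cases i) (simp_all add: lL enat)
        qed
      next
        assume d: "d = ?e"
        have d0: "d 0 = x mod L" and S: "d (Suc i) = x div L div P ^ i mod P" for i
          using d by (simp_all add: lL enat)
        define N where "N = x div L"
        have "N < P ^ N" using P by (simp add: power_gt_expt)
        hence b: "\<forall>i. d (Suc i) < P" "\<forall>i\<ge>N. d (Suc i) = 0"
            "x div L = (\<Sum>i<N. d (Suc i) * P ^ i)"
          using base_digits_iff[OF P, of "\<lambda>i. d (Suc i)" N "x div L"] S N_def by auto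
        have z: "d i = 0" if "i \<notin> {..<Suc N}" for i using b(2) that by (cases i) auto
        have "(\<Sum>i | d i \<noteq> 0. enat (d i) * place l p i) = (\<Sum>i<Suc N. enat (d i) * place l p i)"
          by (rule sum_on) (use z in auto)
        also have "\<dots> = enat x" unfolding sN b(3)[symmetric] d0 by simp
        finally have "(\<Sum>i | d i \<noteq> 0. enat (d i) * place l p i) = enat x" .
        moreover have "finite {i. d i \<noteq> 0}"
          by (rule fin_on[of "{..<Suc N}"]) (use z in auto)
        moreover have "d i < P" if "i \<ge> 1" for i using b(1) that by (cases i) auto
        ultimately show "is_digits l p x d" using L d0 by (auto simp: is_digits_def lL enat)
      qed
    qed
  qed
qed

end

theory Submission
  imports Defs
begin

text \<open>
  Two observations make the theorem a short induction on the number of digits.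

  First, the case distinction defining \<open>etilde l p n m\<close> is a difference in disguise. Put
  \<open>t = (n + m) div 2\<close>. Passing from \<open>t - 1\<close> to \<open>t\<close> raises the digit at position \<open>\<nu>(t)\<close> by
  one and resets all lower digits from their maximal value to \<open>0\<close>. Comparing \<open>\<nu>(t)\<close> with
  \<open>\<nu>(m)\<close> therefore tells when \<open>m\<close> starts or ceases to be dominated, and for \<open>n \<equiv> m\<close> modulo
  \<open>2\<close> the entry is \<open>[m \<triangleleft> t] - [m \<triangleleft> t - 1]\<close> (\<open>etilde_eq_centred_jump\<close>). No valuation is
  left in this form.

  Second, everything is recursive in the lowest digit. For finite \<open>l\<close>, the higher
  \<open>(l,p)\<close>-digits of \<open>x\<close> are the \<open>(p,p)\<close>-digits of \<open>x div l\<close>. Hence row \<open>n = n' l + r\<close> of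
  \<open>dtilde\<close>, with \<open>n' > 0\<close>, is supported on the numbers \<open>k l + r\<close> and \<open>k l - r\<close>, where \<open>k\<close>
  runs through the support of row \<open>n'\<close> for \<open>(p,p)\<close>. For such a pair of indices, which is a
  single index if \<open>r = 0\<close>, the corresponding entries of \<open>etilde\<close> in column \<open>m\<close> add up to
  the \<open>(p,p)\<close>-entry at \<open>(k, m div l)\<close> if \<open>m mod l = r\<close>, and to \<open>0\<close> otherwise
  (\<open>centred_jump_fold\<close>, \<open>centred_jump_multiple\<close>). So the product of row \<open>n\<close> of \<open>dtilde\<close>
  with column \<open>m\<close> of \<open>etilde\<close> reduces to the same product for \<open>n'\<close> and \<open>m div l\<close>, down to
  a single digit, where row \<open>n\<close> of either matrix is that of the identity. Infinite \<open>l\<close>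
  means a single digit, and so falls under this last case.

  This shows \<open>dtilde * etilde = 1\<close>. Both matrices are lower triangular and \<open>dtilde\<close> has
  unit diagonal, so a right inverse of it is also a left inverse. Over a field, the digit
  system makes sense because \<open>l \<ge> 2\<close>, as \<open>[1] = 1 \<noteq> 0\<close>, and \<open>p \<ge> 2\<close>.
\<close>

section \<open>Recursion in the lowest digit\<close>

lemma digits_infinity:
  assumes "p \<ge> 2"
  shows "digits \<infinity> p x = (\<lambda>i. if i = 0 then x else 0)"
  using assms by (simp add: digits_def is_digits_iff)

lemma digits_enat_0:
  assumes "L \<ge> 2" "p \<ge> 2"
  shows "digits (enat L) p x 0 = x mod L"
proof -
  have "enat L \<ge> 2" using assms by (simp add: numeral_eq_enat)
  thus ?thesis using assms by (simp add: digits_def is_digits_iff split: enat.split)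
qed

lemma digits_enat_Suc:
  assumes "L \<ge> 2" "p \<ge> 2"
  shows "digits (enat L) p x (Suc i) = digits p p (x div L) i"
proof -
  have "enat L \<ge> 2" using assms by (simp add: numeral_eq_enat)
  thus ?thesis using assms
    by (cases i) (simp_all add: digits_def is_digits_iff div_mult2_eq split: enat.split)
qed

lemma dominates_infinity:
  assumes "p \<ge> 2"
  shows "dominates \<infinity> p x y \<longleftrightarrow> y \<le> x"
  using assms by (auto simp: dominates_def digits_infinity)

lemma dominates_enat:
  assumes "L \<ge> 2" "p \<ge> 2"
  shows "dominates (enat L) p x y \<longleftrightarrow> y mod L \<le> x mod L \<and> dominates p p (x div L) (y div L)"
proof -
  have "(\<forall>i. P i) \<longleftrightarrow> P 0 \<and> (\<forall>i. P (Suc i))" for P :: "nat \<Rightarrow> bool"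
    by (metis nat.exhaust)
  from this[of "\<lambda>i. digits (enat L) p y i \<le> digits (enat L) p x i"] show ?thesis
    unfolding dominates_def by (simp add: digits_enat_0 digits_enat_Suc assms)
qed

lemma dominates_refl: "dominates l p x x"
  by (simp add: dominates_def)

lemma dominates_imp_le:
  assumes "l \<ge> 2" "p \<ge> 2" "dominates l p x y"
  shows "y \<le> x"
  using assms
proof (induction y arbitrary: l x rule: less_induct)
  case (less y)
  show ?case
  proof (cases l)
    case infinity
    thus ?thesis using less.prems by (simp add: dominates_infinity)
  next
    case (enat L)
    hence L: "L \<ge> 2" using less.prems by (simp add: numeral_eq_enat)
    have d: "y mod L \<le> x mod L" "dominates p p (x div L) (y div L)"
      using less.prems enat L by (simp_all add: dominates_enat)
    have "y div L \<le> x div L"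
    proof (cases "y = 0")
      case False
      hence "y div L < y" using L by simp
      thus ?thesis using less.IH d less.prems by blast
    qed simp
    hence "y div L * L + y mod L \<le> x div L * L + x mod L"
      using d(1) by (intro add_mono mult_right_mono) simp_all
    thus ?thesis by simp
  qed
qed

lemma digits_eq_0_imp_eq_0:
  assumes "l \<ge> 2" "p \<ge> 2" "\<And>i. digits l p x i = 0"
  shows "x = 0"
  using dominates_imp_le[OF assms(1,2), of 0 x] assms(3) by (simp add: dominates_def)

lemma nu_enat:
  assumes "L \<ge> 2" "p \<ge> 2" "x > 0"
  shows "nu (enat L) p x = (if L dvd x then Suc (nu p p (x div L)) else 0)"
proof (cases "L dvd x \<and> p \<noteq> \<infinity>")
  case True
  then obtain P y where p: "p = enat P" and x: "x = L * y"
    by (auto elim!: dvdE)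
  have P: "P \<ge> 2" using assms p by (simp add: numeral_eq_enat)
  have y: "y > 0" using assms x by simp
  have "multiplicity P y = (if P dvd y then Suc (multiplicity P (y div P)) else 0)"
  proof (cases "P dvd y")
    case True
    then obtain z where "y = P * z" by (elim dvdE)
    thus ?thesis using P y by (simp add: multiplicity_times_same)
  qed (simp add: not_dvd_imp_multiplicity_0)
  thus ?thesis using assms x p by (simp add: nu_def)
qed (auto simp: nu_def split: enat.split)


section \<open>The entries of the inverse as differences\<close>

definition jump :: "enat \<Rightarrow> enat \<Rightarrow> nat \<Rightarrow> nat \<Rightarrow> int" where
  "jump l p t m = of_bool (dominates l p t m) - of_bool (dominates l p (t - 1) m)"

definition centred_jump :: "enat \<Rightarrow> enat \<Rightarrow> nat \<Rightarrow> nat \<Rightarrow> int" where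
  "centred_jump l p n m = (if even (n + m) then jump l p ((n + m) div 2) m else 0)"

lemma pred_div_mod:
  fixes t L :: nat
  assumes "t \<ge> 1" "L \<ge> 2"
  shows "(t - 1) mod L = (if L dvd t then L - 1 else t mod L - 1)"
    and "(t - 1) div L = (if L dvd t then t div L - 1 else t div L)"
proof -
  obtain t' where t: "t = Suc t'" using assms by (cases t) auto
  show "(t - 1) mod L = (if L dvd t then L - 1 else t mod L - 1)"
    using assms by (auto simp: t mod_Suc dvd_eq_mod_eq_0 split: if_splits)
  show "(t - 1) div L = (if L dvd t then t div L - 1 else t div L)"
    using assms by (auto simp: t div_Suc dvd_eq_mod_eq_0)
qed

text \<open>While \<open>t\<close> runs through a block of \<open>L\<close> consecutive numbers with the same higher digits, the
  comparison of lowest digits switches on when \<open>t mod L\<close> reaches \<open>m mod L\<close>. At the start of the next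
  block the old higher digits are lost. If \<open>m mod L = 0\<close>, both happen for the same \<open>t\<close>.\<close>

lemma jump_enat:
  assumes "L \<ge> 2" "p \<ge> 2" "t \<ge> 1"
  shows "jump (enat L) p t m =
    of_bool (t mod L = m mod L \<and> dominates p p (t div L) (m div L))
    - of_bool (L dvd t \<and> dominates p p (t div L - 1) (m div L))"
proof -
  have le: "m mod L \<le> L - 1" using assms by (simp add: Suc_leI less_Suc_eq_le[symmetric])
  have mod: "t mod L = 0 \<longleftrightarrow> L dvd t" by (simp add: dvd_eq_mod_eq_0)
  show ?thesis
    unfolding jump_def dominates_enat[OF assms(1,2)] pred_div_mod[OF assms(3,1)]
  proof (cases "L dvd t")
    case True
    thus "of_bool (m mod L \<le> t mod L \<and> dominates p p (t div L) (m div L))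
      - of_bool (m mod L \<le> (if L dvd t then L - 1 else t mod L - 1)
          \<and> dominates p p (if L dvd t then t div L - 1 else t div L) (m div L)) =
      (of_bool (t mod L = m mod L \<and> dominates p p (t div L) (m div L))
      - of_bool (L dvd t \<and> dominates p p (t div L - 1) (m div L)) :: int)"
      using le mod by auto
  next
    case False
    hence "t mod L > 0" using mod by simp
    thus "of_bool (m mod L \<le> t mod L \<and> dominates p p (t div L) (m div L))
      - of_bool (m mod L \<le> (if L dvd t then L - 1 else t mod L - 1)
          \<and> dominates p p (if L dvd t then t div L - 1 else t div L) (m div L)) =
      (of_bool (t mod L = m mod L \<and> dominates p p (t div L) (m div L))
      - of_bool (L dvd t \<and> dominates p p (t div L - 1) (m div L)) :: int)"
      using False by auto
  qed
qed

text \<open>The induction strips lowest digits as long as they vanish in both \<open>t\<close> and \<open>m\<close>. As soon as one of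
  them does not, the lowest digits alone decide which case of the definition applies.\<close>

lemma jump_eq_cases:
  assumes "l \<ge> 2" "p \<ge> 2" "t \<ge> 1" "m \<ge> 1"
  shows "jump l p t m =
    (if nu l p t > nu l p m \<and> dominates l p (t - 1) m then -1
     else if nu l p t = nu l p m \<and> dot_dominates l p t m then 1 else 0)"
  using assms
proof (induction t arbitrary: l m rule: less_induct)
  case (less t)
  show ?case
  proof (cases l)
    case infinity
    thus ?thesis using less.prems
      by (auto simp: jump_def dot_dominates_def dominates_infinity digits_infinity nu_def)
  next
    case (enat L)
    hence L: "L \<ge> 2" using less.prems by (simp add: numeral_eq_enat)
    have tp: "t > 0" "m > 0" using less.prems by auto
    note rec = dominates_enat[OF L \<open>p \<ge> 2\<close>] nu_enat[OF L \<open>p \<ge> 2\<close>]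
      digits_enat_0[OF L \<open>p \<ge> 2\<close>] digits_enat_Suc[OF L \<open>p \<ge> 2\<close>]
    show ?thesis
    proof (cases "L dvd t")
      case False
      thus ?thesis unfolding enat jump_enat[OF L \<open>p \<ge> 2\<close> \<open>t \<ge> 1\<close>] dot_dominates_def
        using tp by (auto simp: rec dvd_eq_mod_eq_0)
    next
      case True
      then obtain u where u: "t = L * u" by (elim dvdE)
      have u1: "u \<ge> 1" "u < t" using u tp L by auto
      have pm: "(t - 1) div L = u - 1" "(t - 1) mod L = L - 1"
        using pred_div_mod[of t L] tp L u by auto
      show ?thesis
      proof (cases "L dvd m")
        case False
        hence "m mod L \<noteq> 0" "m mod L \<le> L - 1"
          using L by (auto simp: dvd_eq_mod_eq_0 less_Suc_eq_le[symmetric])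
        thus ?thesis unfolding enat jump_enat[OF L \<open>p \<ge> 2\<close> \<open>t \<ge> 1\<close>] dot_dominates_def
          using tp pm u L False by (auto simp: rec)
      next
        case True
        then obtain m' where m: "m = L * m'" by (elim dvdE)
        have m1: "m' \<ge> 1" using m tp by auto
        have "jump l p t m = jump p p u m'"
          unfolding enat jump_enat[OF L \<open>p \<ge> 2\<close> \<open>t \<ge> 1\<close>] jump_def[of p]
          using u m L by simp
        also have "\<dots> = (if nu p p u > nu p p m' \<and> dominates p p (u - 1) m' then -1
           else if nu p p u = nu p p m' \<and> dot_dominates p p u m' then 1 else 0)"
          using less.IH[OF u1(2), of p m'] less.prems u1 m1 by blast
        also have "\<dots> = (if nu l p t > nu l p m \<and> dominates l p (t - 1) m then -1
           else if nu l p t = nu l p m \<and> dot_dominates l p t m then 1 else 0)"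
        proof -
          have nus: "nu l p t = Suc (nu p p u)" "nu l p m = Suc (nu p p m')"
            using tp u m L by (simp_all add: enat rec)
          have "dominates l p (t - 1) m \<longleftrightarrow> dominates p p (u - 1) m'"
            using pm m L by (simp add: enat rec)
          moreover have "dot_dominates l p t m \<longleftrightarrow> dot_dominates p p u m'"
            unfolding dot_dominates_def nus using u m L by (simp add: enat rec)
          ultimately show ?thesis unfolding nus by simp
        qed
        finally show ?thesis .
      qed
    qed
  qed
qed

lemma etilde_eq_centred_jump:
  assumes "l \<ge> 2" "p \<ge> 2" "n \<ge> 1" "m \<ge> 1"
  shows "etilde l p n m = centred_jump l p n m"
proof (cases "even (n + m)")
  case True
  have "n mod 2 = m mod 2" using True by presburger
  moreover have "(n + m) div 2 \<ge> 1" using assms by linarith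
  ultimately show ?thesis
    using jump_eq_cases[OF assms(1,2) _ assms(4)] True by (simp add: etilde_def centred_jump_def)
next
  case False
  hence "n mod 2 \<noteq> m mod 2" by presburger
  thus ?thesis using False by (simp add: etilde_def centred_jump_def)
qed

lemma centred_jump_eq_0:
  assumes "l \<ge> 2" "p \<ge> 2" "n < m"
  shows "centred_jump l p n m = 0"
proof -
  have "(n + m) div 2 < m" "(n + m) div 2 - 1 < m" using assms by linarith+
  hence "\<not> dominates l p ((n + m) div 2) m" "\<not> dominates l p ((n + m) div 2 - 1) m"
    using dominates_imp_le[OF assms(1,2)] by (meson not_le)+
  thus ?thesis by (simp add: centred_jump_def jump_def)
qed

lemma dominates_single_digit:
  assumes "l \<ge> 2" "p \<ge> 2" "enat x < l" "enat y < l"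
  shows "dominates l p x y \<longleftrightarrow> y \<le> x"
proof (cases l)
  case (enat L)
  hence "L \<ge> 2" using assms by (simp add: numeral_eq_enat)
  thus ?thesis using assms enat by (simp add: dominates_enat dominates_refl)
qed (use assms in \<open>simp add: dominates_infinity\<close>)

lemma centred_jump_single_digit:
  assumes "l \<ge> 2" "p \<ge> 2" "n \<ge> 1" "enat n < l"
  shows "centred_jump l p n m = of_bool (n = m)"
proof (cases "m \<le> n")
  case True
  have less: "enat k < l" if "k \<le> n" for k
    using that assms(4) by (meson enat_ord_simps(1) le_less_trans)
  have "dominates l p ((n + m) div 2) m \<longleftrightarrow> m \<le> (n + m) div 2"
       "dominates l p ((n + m) div 2 - 1) m \<longleftrightarrow> m \<le> (n + m) div 2 - 1"
    using True by (intro dominates_single_digit assms(1,2) less; linarith)+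
  moreover have "m \<le> (n + m) div 2 - 1 \<longleftrightarrow> n \<noteq> m" if "even (n + m)"
    using that True assms(3) by presburger
  ultimately show ?thesis using True by (auto simp: centred_jump_def jump_def)
qed (use assms in \<open>simp add: centred_jump_eq_0\<close>)

lemma quotient_remainder_unique:
  fixes q r q' r' L :: nat
  assumes "q * L + r = q' * L + r'" "r < L" "r' < L"
  shows "q = q' \<and> r = r'"
  using assms by (metis add.commute div_mult_self1 div_less add_0 mod_mult_self1 mod_less
      less_nat_zero_code)

text \<open>Write \<open>m = m' L + r'\<close> and let \<open>t\<close> be the midpoint of \<open>k L + r\<close> and \<open>m\<close>, so that \<open>t - r\<close> is the
  midpoint of \<open>k L - r\<close> and \<open>m\<close>. A jump at \<open>t\<close> or \<open>t - r\<close> requires residue \<open>r'\<close> or \<open>0\<close>. Since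
  \<open>2 t = (k + m') L + r + r'\<close>, this leaves \<open>r' = r\<close> with \<open>k + m'\<close> even, where the switching-on
  at \<open>t\<close> and the loss at \<open>t - r\<close> combine to a jump of the higher digits, and \<open>r' = L - r\<close> with
  \<open>k + m'\<close> odd, where the switching-on at \<open>t - r\<close> is undone at \<open>t\<close>.\<close>

lemma centred_jump_fold:
  assumes L: "L \<ge> 2" and p: "p \<ge> 2" and k: "k \<ge> 1" and r: "0 < r" "r < L"
  shows "centred_jump (enat L) p (k * L + r) m + centred_jump (enat L) p (k * L - r) m =
    of_bool (m mod L = r) * centred_jump p p k (m div L)"
proof -
  define r' m' where "r' = m mod L" and "m' = m div L"
  have m: "m = m' * L + r'" and r': "r' < L"
    using L by (simp_all add: r'_def m'_def)
  have kL: "r < k * L"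
    using r(2) k mult_le_mono1[of 1 k L] by linarith
  show ?thesis
  proof (cases "even (k * L + r + m)")
    case False
    moreover have "odd (k * L - r + m)" using False kL by auto
    moreover have "odd (k + m')" if "r' = r"
      using False that by (auto simp: m algebra_simps)
    ultimately show ?thesis
      by (auto simp: centred_jump_def r'_def m'_def)
  next
    case True
    then obtain t where t: "k * L + r + m = 2 * t" by (elim evenE)
    have t2: "k * L - r + m = 2 * (t - r)" and tr: "t - r \<ge> 1" "t \<ge> 1"
      using t kL by linarith+
    have tt: "2 * t = (k + m') * L + (r + r')"
      using t by (simp add: m algebra_simps)
    have lhs: "centred_jump (enat L) p (k * L + r) m + centred_jump (enat L) p (k * L - r) m =
        jump (enat L) p t m + jump (enat L) p (t - r) m"
      unfolding centred_jump_def t t2 by simp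
    have on: "r' = r \<and> even (k + m')" if "t mod L = r'"
    proof -
      have "t = t div L * L + r'" using that by (metis div_mult_mod_eq)
      hence "2 * (t div L) * L + r' = (k + m') * L + r" using tt by simp
      hence "2 * (t div L) = k + m' \<and> r' = r"
        using quotient_remainder_unique r' r(2) by metis
      thus ?thesis by (metis even_mult_iff dvd_refl)
    qed
    have sum_eq: "r + r' = L" if dvd: "L dvd r + r'"
    proof -
      obtain c where c: "r + r' = L * c" using dvd by (elim dvdE)
      hence "c = 1" using r r' L by (cases c; cases "c - 1") auto
      thus ?thesis using c by simp
    qed
    have off: "r' = L - r \<and> odd (k + m')" if "L dvd t"
    proof -
      have "t = t div L * L" using that by simp
      hence eq: "2 * (t div L) * L = (k + m') * L + (r + r')" using tt by simp
      hence "L dvd r + r'" by (metis dvd_add_right_iff dvd_triv_right)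
      hence sum: "r + r' = L" by (rule sum_eq)
      hence "2 * (t div L) * L + 0 = Suc (k + m') * L + 0" using eq by simp
      hence "2 * (t div L) = Suc (k + m')"
        by (rule quotient_remainder_unique[THEN conjunct1]) (use L in simp_all)
      moreover have "even (2 * (t div L))" by simp
      ultimately have "odd (k + m')" by (metis even_Suc)
      thus ?thesis using sum by simp
    qed
    have on2: "r' = L - r \<and> odd (k + m')" if "(t - r) mod L = r'"
    proof -
      have "t - r = (t - r) div L * L + r'" using that by (metis div_mult_mod_eq)
      hence eq: "2 * ((t - r) div L) * L + (r + r') = (k + m') * L" using tt tr by simp
      hence "L dvd r + r'" by (metis dvd_add_right_iff dvd_triv_right)
      hence sum: "r + r' = L" by (rule sum_eq)
      hence "Suc (2 * ((t - r) div L)) * L + 0 = (k + m') * L + 0" using eq by simp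
      hence "Suc (2 * ((t - r) div L)) = k + m'"
        by (rule quotient_remainder_unique[THEN conjunct1]) (use L in simp_all)
      moreover have "odd (Suc (2 * ((t - r) div L)))" by simp
      ultimately have "odd (k + m')" by metis
      thus ?thesis using sum by simp
    qed
    have off2: "r' = r \<and> even (k + m')" if "L dvd t - r"
    proof -
      have "t - r = (t - r) div L * L" using that by simp
      hence "2 * ((t - r) div L) * L + r = (k + m') * L + r'" using tt tr by simp
      hence "2 * ((t - r) div L) = k + m' \<and> r = r'"
        using quotient_remainder_unique r' r(2) by metis
      thus ?thesis by (metis even_mult_iff dvd_refl)
    qed
    consider (same) "r' = r" "even (k + m')" | (opposite) "r' = L - r" "odd (k + m')"
      | (none) "\<not> (r' = r \<and> even (k + m'))" "\<not> (r' = L - r \<and> odd (k + m'))" by blast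
    thus ?thesis
    proof cases
      case same
      then obtain u where u: "k + m' = 2 * u" by (elim evenE)
      have t_u: "t = u * L + r" using tt u same by simp
      have "\<not> L dvd t" using off same by blast
      moreover have "(t - r) mod L \<noteq> r'" using on2 same by blast
      moreover have "t mod L = r'" "t div L = u" "L dvd t - r" "(t - r) div L = u"
        using same r t_u L by simp_all
      ultimately have "jump (enat L) p t m + jump (enat L) p (t - r) m = jump p p u m'"
        unfolding jump_enat[OF L p tr(1)] jump_enat[OF L p tr(2)] jump_def[of p]
        by (simp flip: r'_def m'_def)
      thus ?thesis unfolding lhs r'_def[symmetric] m'_def[symmetric]
        using same u by (simp add: centred_jump_def)
    next
      case opposite
      then obtain u where u: "k + m' = Suc (2 * u)" by (elim oddE) simp
      have t_u: "t = Suc u * L" "t - r = u * L + r'" using tt u opposite r by simp_all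
      have "t mod L \<noteq> r'" using on opposite by blast
      moreover have "\<not> L dvd t - r" using off2 opposite by blast
      moreover have "L dvd t" "t div L - 1 = u"
        unfolding t_u(1) using L by (simp_all del: mult_Suc)
      moreover have "(t - r) mod L = r'" "(t - r) div L = u"
        unfolding t_u(2) using r' by simp_all
      ultimately have "jump (enat L) p t m + jump (enat L) p (t - r) m = 0"
        unfolding jump_enat[OF L p tr(1)] jump_enat[OF L p tr(2)]
        by (simp flip: r'_def m'_def)
      thus ?thesis unfolding lhs r'_def[symmetric] m'_def[symmetric]
        using opposite by (simp add: centred_jump_def)
    next
      case none
      have "t mod L \<noteq> r'" "\<not> L dvd t - r" using on off2 none(1) by blast+
      moreover have "\<not> L dvd t" "(t - r) mod L \<noteq> r'"
        using off on2 none(2) by blast+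
      ultimately have "jump (enat L) p t m + jump (enat L) p (t - r) m = 0"
        unfolding jump_enat[OF L p tr(1)] jump_enat[OF L p tr(2)]
        by (simp flip: r'_def m'_def)
      thus ?thesis unfolding lhs r'_def[symmetric] m'_def[symmetric]
        using none by (auto simp: centred_jump_def)
    qed
  qed
qed

lemma centred_jump_multiple:
  assumes L: "L \<ge> 2" and p: "p \<ge> 2" and k: "k \<ge> 1"
  shows "centred_jump (enat L) p (k * L) m = of_bool (m mod L = 0) * centred_jump p p k (m div L)"
proof -
  define r' m' where "r' = m mod L" and "m' = m div L"
  have m: "m = m' * L + r'" and r': "r' < L"
    using L by (simp_all add: r'_def m'_def)
  show ?thesis
  proof (cases "even (k * L + m)")
    case False
    moreover have "odd (k + m')" if "r' = 0"
      using False that by (auto simp: m algebra_simps)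
    ultimately show ?thesis by (auto simp: centred_jump_def r'_def m'_def)
  next
    case True
    then obtain t where t: "k * L + m = 2 * t" by (elim evenE)
    have "k * L \<ge> 1" using L k by simp
    hence t1: "t \<ge> 1" using t by linarith
    have tt: "2 * t = (k + m') * L + r'"
      using t by (simp add: m algebra_simps)
    have lhs: "centred_jump (enat L) p (k * L) m = jump (enat L) p t m"
      unfolding centred_jump_def t by simp
    have on: "r' = 0 \<and> k + m' = 2 * (t div L)" if "t mod L = r'"
    proof -
      have "t = t div L * L + r'" using that by (metis div_mult_mod_eq)
      hence "2 * (t div L) * L + r' = (k + m') * L + 0" using tt by simp
      hence "2 * (t div L) = k + m' \<and> r' = 0"
        by (rule quotient_remainder_unique) (use r' L in simp_all)
      thus ?thesis by simp
    qed
    have off: "t mod L = r'" if "L dvd t"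
    proof -
      have "t = t div L * L" using that by simp
      hence "2 * (t div L) * L + 0 = (k + m') * L + r'" using tt by simp
      hence "2 * (t div L) = k + m' \<and> 0 = r'"
        by (rule quotient_remainder_unique) (use r' L in simp_all)
      thus ?thesis using that by simp
    qed
    show ?thesis
    proof (cases "t mod L = r'")
      case True
      note u = on[OF True]
      have "jump (enat L) p t m = jump p p (t div L) m'"
        unfolding jump_enat[OF L p t1] jump_def[of p]
        using True u by (simp add: dvd_eq_mod_eq_0 flip: r'_def m'_def)
      thus ?thesis unfolding lhs r'_def[symmetric] m'_def[symmetric]
        using u by (simp add: centred_jump_def)
    next
      case False
      hence "jump (enat L) p t m = 0"
        unfolding jump_enat[OF L p t1] using off by (auto simp flip: r'_def m'_def)
      moreover have "odd (k + m')" if "r' = 0"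
      proof
        assume "even (k + m')"
        then obtain u where "k + m' = 2 * u" by (elim evenE)
        hence "t = u * L" using tt that by simp
        thus False using False that by simp
      qed
      ultimately show ?thesis unfolding lhs r'_def[symmetric] m'_def[symmetric]
        by (auto simp: centred_jump_def)
    qed
  qed
qed


section \<open>The support of a row\<close>

definition signed_value :: "enat \<Rightarrow> enat \<Rightarrow> nat \<Rightarrow> nat \<Rightarrow> (nat \<Rightarrow> int) \<Rightarrow> int" where
  "signed_value l p n k s = int (digits l p n k * the_enat (place l p k))
     + (\<Sum>i<k. s i * int (digits l p n i * the_enat (place l p i)))"

definition leading_position :: "enat \<Rightarrow> enat \<Rightarrow> nat \<Rightarrow> nat \<Rightarrow> bool" where
  "leading_position l p n k \<longleftrightarrow> digits l p n k \<noteq> 0 \<and> (\<forall>i>k. digits l p n i = 0)"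

text \<open>This is the support shifted by one in both arguments, which makes it homogeneous in the
  digits.\<close>

definition signed_values :: "enat \<Rightarrow> enat \<Rightarrow> nat \<Rightarrow> int set" where
  "signed_values l p n =
     {signed_value l p n k s | k s. leading_position l p n k \<and> (\<forall>i<k. s i \<in> {1, -1})}"

lemma dtilde_eq_signed_values:
  assumes "n \<ge> 1" "m \<ge> 1"
  shows "dtilde l p n m = of_bool (int m \<in> signed_values l p n)"
proof -
  have "supp l p (n - 1) = (\<lambda>x. x - 1) ` signed_values l p n"
    unfolding supp_def signed_values_def signed_value_def leading_position_def using assms(1)
    by (auto simp: image_iff)
  moreover have "int (m - 1) = int m - 1" using assms(2) by simp
  ultimately show ?thesis by (auto simp: dtilde_def)
qed

lemma signed_values_single_digit:
  assumes l: "l \<ge> 2" and p: "p \<ge> 2" and n: "n \<ge> 1" "enat n < l"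
  shows "signed_values l p n = {int n}"
proof -
  have d: "digits l p n i = (if i = 0 then n else 0)" for i
  proof (cases l)
    case (enat L)
    hence L: "L \<ge> 2" using l by (simp add: numeral_eq_enat)
    have "digits q p 0 j = 0" if "q \<ge> 2" for q j
      using that p by (simp add: digits_def is_digits_iff split: enat.split)
    thus ?thesis using enat n L p
      by (cases i) (simp_all add: digits_enat_0 digits_enat_Suc)
  qed (use p in \<open>simp add: digits_infinity\<close>)
  have "leading_position l p n k \<longleftrightarrow> k = 0" for k
    using n by (auto simp: leading_position_def d)
  moreover have "signed_value l p n 0 s = int n" for s
    by (simp add: signed_value_def d place_def one_enat_def)
  ultimately show ?thesis by (auto simp: signed_values_def)
qed

text \<open>Places below a nonzero digit are finite, so the conversion to natural numbers respects
  the product.\<close>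

lemma the_enat_place_Suc:
  assumes "p \<ge> 2" "digits p p y k \<noteq> 0" "i \<le> k"
  shows "the_enat (place (enat L) p (Suc i)) = L * the_enat (place p p i)"
proof -
  have "place p p i \<noteq> \<infinity>"
  proof (cases p)
    case infinity
    hence "i = 0" using assms by (auto simp: digits_infinity split: if_splits)
    thus ?thesis by (simp add: place_def)
  next
    case (enat P)
    have "enat P ^ j = enat (P ^ j)" for j by (induction j) (simp_all add: one_enat_def)
    thus ?thesis by (simp add: place_def enat one_enat_def)
  qed
  then obtain w where w: "place p p i = enat w" by blast
  have "place (enat L) p (Suc i) = enat L * place p p i"
    by (cases i) (simp_all add: place_def)
  thus ?thesis by (simp add: w)
qed

lemma signed_value_Suc:
  assumes "L \<ge> 2" "p \<ge> 2" "digits p p (n div L) k \<noteq> 0"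
  shows "signed_value (enat L) p n (Suc k) s =
    int L * signed_value p p (n div L) k (\<lambda>i. s (Suc i)) + s 0 * int (n mod L)"
proof -
  have "(\<Sum>i<k. s (Suc i) * int (digits p p (n div L) i * the_enat (place (enat L) p (Suc i)))) =
      int L * (\<Sum>i<k. s (Suc i) * int (digits p p (n div L) i * the_enat (place p p i)))"
    unfolding sum_distrib_left
    by (rule sum.cong) (simp_all add: the_enat_place_Suc[OF assms(2,3)])
  moreover have "the_enat (place (enat L) p 0) = 1" by (simp add: place_def one_enat_def)
  ultimately show ?thesis
    unfolding signed_value_def sum.lessThan_Suc_shift using assms
    by (simp add: digits_enat_0 digits_enat_Suc the_enat_place_Suc[OF assms(2,3)] algebra_simps)
qed

lemma leading_position_Suc:
  assumes "L \<ge> 2" "p \<ge> 2"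
  shows "leading_position (enat L) p n (Suc k) \<longleftrightarrow> leading_position p p (n div L) k"
proof -
  have "(\<forall>i>Suc k. digits (enat L) p n i = 0) \<longleftrightarrow> (\<forall>i>k. digits (enat L) p n (Suc i) = 0)"
    by (metis Suc_less_eq Suc_lessE)
  thus ?thesis by (simp add: leading_position_def digits_enat_Suc assms)
qed

lemma not_leading_position_0:
  assumes "L \<ge> 2" "p \<ge> 2" "n \<ge> L"
  shows "\<not> leading_position (enat L) p n 0"
proof
  assume "leading_position (enat L) p n 0"
  hence "digits p p (n div L) i = 0" for i
    using assms by (simp add: leading_position_def flip: digits_enat_Suc)
  hence "n div L = 0" using digits_eq_0_imp_eq_0 assms by blast
  thus False using assms by (simp add: div_eq_0_iff)
qed

lemma signed_values_enat:
  assumes L: "L \<ge> 2" and p: "p \<ge> 2" and n: "n \<ge> L"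
  shows "signed_values (enat L) p n =
    (\<lambda>x. int L * x + int (n mod L)) ` signed_values p p (n div L) \<union>
    (\<lambda>x. int L * x - int (n mod L)) ` signed_values p p (n div L)"
    (is "?A = ?f ` ?B \<union> ?g ` ?B")
proof (rule set_eqI, rule iffI)
  fix x assume "x \<in> ?A"
  then obtain k s where ks: "leading_position (enat L) p n k" "\<And>i. i < k \<Longrightarrow> s i \<in> {1, -1}"
    and x: "x = signed_value (enat L) p n k s"
    by (auto simp: signed_values_def)
  obtain j where j: "k = Suc j"
    using ks(1) not_leading_position_0[OF assms] by (cases k) auto
  have lead: "leading_position p p (n div L) j"
    using ks(1) leading_position_Suc[OF L p] j by simp
  have "signed_value p p (n div L) j (\<lambda>i. s (Suc i)) \<in> ?B"
    unfolding signed_values_def using lead ks(2) j by blast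
  moreover have "x = int L * signed_value p p (n div L) j (\<lambda>i. s (Suc i)) + s 0 * int (n mod L)"
    unfolding x j using lead by (intro signed_value_Suc L p) (simp add: leading_position_def)
  moreover have "s 0 \<in> {1, -1}" using ks(2) j by simp
  ultimately show "x \<in> ?f ` ?B \<union> ?g ` ?B" by auto
next
  fix x assume "x \<in> ?f ` ?B \<union> ?g ` ?B"
  then obtain y c where y: "y \<in> ?B" and c: "c \<in> {1, -1}" and x: "x = int L * y + c * int (n mod L)"
    by fastforce
  from y obtain k s where ks: "leading_position p p (n div L) k" "\<forall>i<k. s i \<in> {1, -1}"
    and y_eq: "y = signed_value p p (n div L) k s"
    by (auto simp: signed_values_def)
  define s' where "s' = (\<lambda>i. case i of 0 \<Rightarrow> c | Suc j \<Rightarrow> s j)"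
  have "x = signed_value (enat L) p n (Suc k) s'"
    using signed_value_Suc[OF L p, of n k s'] ks(1)
    by (simp add: x y_eq s'_def leading_position_def)
  moreover have "\<forall>i<Suc k. s' i \<in> {1, -1}"
    using ks(2) c by (auto simp: s'_def split: nat.split)
  ultimately show "x \<in> ?A"
    unfolding signed_values_def using leading_position_Suc[OF L p] ks(1) by blast
qed

text \<open>The step strips the lowest digit. This turns an \<open>(l,p)\<close>-expansion into a
  \<open>(p,p)\<close>-expansion, so that \<open>l\<close> has to vary along with \<open>n\<close>.\<close>

lemma digit_induct [consumes 3, case_names single more]:
  assumes "l \<ge> 2" "p \<ge> 2" "n \<ge> 1"
    and single: "\<And>l n. l \<ge> 2 \<Longrightarrow> n \<ge> 1 \<Longrightarrow> enat n < l \<Longrightarrow> P l n"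
    and more: "\<And>L n. L \<ge> 2 \<Longrightarrow> n \<ge> L \<Longrightarrow> n div L \<ge> 1 \<Longrightarrow> P p (n div L) \<Longrightarrow> P (enat L) n"
  shows "P l n"
  using assms(1,3)
proof (induction n arbitrary: l rule: less_induct)
  case (less n)
  show ?case
  proof (cases "enat n < l")
    case False
    then obtain L where L: "l = enat L" by (cases l) auto
    have L2: "L \<ge> 2" "n \<ge> L" using less.prems False L by (simp_all add: numeral_eq_enat)
    have d: "n div L \<ge> 1" "n div L < n"
      using L2 by (simp_all add: div_greater_zero_iff Suc_le_eq)
    show ?thesis unfolding L by (rule more[OF L2 d(1) less.IH[OF d(2) \<open>p \<ge> 2\<close> d(1)]])
  qed (use single less.prems in blast)
qed

lemma self_in_signed_values:
  assumes "l \<ge> 2" "p \<ge> 2" "n \<ge> 1"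
  shows "int n \<in> signed_values l p n"
  using assms
proof (induction rule: digit_induct)
  case (more L n)
  have "int n = int L * int (n div L) + int (n mod L)"
    by (metis mult_div_mod_eq of_nat_add of_nat_mult)
  thus ?case unfolding signed_values_enat[OF more(1) \<open>p \<ge> 2\<close> more(2)] using more by blast
qed (simp add: signed_values_single_digit \<open>p \<ge> 2\<close>)

lemma signed_values_bounds:
  assumes "l \<ge> 2" "p \<ge> 2" "n \<ge> 1"
  shows "signed_values l p n \<subseteq> {1..int n}"
  using assms
proof (induction rule: digit_induct)
  case (more L n)
  let ?r = "int (n mod L)"
  have r: "0 \<le> ?r" "?r < int L" using more by auto
  have n: "int n = int L * int (n div L) + ?r"
    by (metis mult_div_mod_eq of_nat_add of_nat_mult)
  have "int L * x + ?r \<in> {1..int n} \<and> int L * x - ?r \<in> {1..int n}"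
    if "x \<in> signed_values p p (n div L)" for x
  proof -
    have x: "1 \<le> x" "x \<le> int (n div L)" using that more by auto
    have "int L * 1 \<le> int L * x" "int L * x \<le> int L * int (n div L)"
      using x by (intro mult_left_mono; simp)+
    thus ?thesis unfolding n atLeastAtMost_iff using r by linarith
  qed
  thus ?case unfolding signed_values_enat[OF more(1) \<open>p \<ge> 2\<close> more(2)] by blast
qed (simp add: signed_values_single_digit \<open>p \<ge> 2\<close>)

lemma signed_values_parity:
  assumes "l \<ge> 2" "p \<ge> 2" "n \<ge> 1"
  shows "\<forall>x \<in> signed_values l p n. even (x - int n)"
  using assms
proof (induction rule: digit_induct)
  case (more L n)
  have n: "int n = int L * int (n div L) + int (n mod L)"
    by (metis mult_div_mod_eq of_nat_add of_nat_mult)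
  have "even (int L * x + int (n mod L) - int n)" "even (int L * x - int (n mod L) - int n)"
    if "x \<in> signed_values p p (n div L)" for x
  proof -
    have "int L * x + int (n mod L) - int n = int L * (x - int (n div L))"
      "int L * x - int (n mod L) - int n = int L * (x - int (n div L)) - 2 * int (n mod L)"
      unfolding n by (simp_all only: algebra_simps)
    thus "even (int L * x + int (n mod L) - int n)" "even (int L * x - int (n mod L) - int n)"
      using more.IH that by (metis dvd_mult dvd_diff dvd_triv_left)+
  qed
  thus ?case unfolding signed_values_enat[OF more(1) \<open>p \<ge> 2\<close> more(2)] by blast
qed (simp add: signed_values_single_digit \<open>p \<ge> 2\<close>)

lemma finite_signed_values:
  assumes "l \<ge> 2" "p \<ge> 2" "n \<ge> 1"
  shows "finite (signed_values l p n)"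
  using signed_values_bounds[OF assms] by (rule finite_subset) simp


section \<open>The product of the two matrices\<close>

text \<open>The two halves of the support of a row have to be disjoint, so that the folded sums can be
  taken term by term. If \<open>L x + r = L y - r\<close> with \<open>0 < r < L\<close>, then \<open>L = 2 r\<close> and \<open>y = x + 1\<close>,
  which is excluded because all elements of the support have the same parity.
  The induction passes from column \<open>m\<close> to column \<open>m div L\<close> and so has to cover column \<open>0\<close>, where all entries of \<open>centred_jump\<close> vanish in positive rows.\<close>

lemma row_times_column:
  assumes "l \<ge> 2" "p \<ge> 2" "n \<ge> 1"
  shows "(\<Sum>x\<in>signed_values l p n. centred_jump l p (nat x) m) = of_bool (n = m)"
  using assms
proof (induction arbitrary: m rule: digit_induct)
  case (single l n)
  thus ?case using \<open>p \<ge> 2\<close> by (simp add: signed_values_single_digit centred_jump_single_digit)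
next
  case (more L n)
  note L = \<open>L \<ge> 2\<close> and p = \<open>p \<ge> 2\<close>
  define r where "r = n mod L"
  define B where "B = signed_values p p (n div L)"
  define f g where "f = (\<lambda>x. int L * x + int r)" and "g = (\<lambda>x. int L * x - int r)"
  have A: "signed_values (enat L) p n = f ` B \<union> g ` B"
    unfolding f_def g_def r_def B_def by (rule signed_values_enat[OF L p more(2)])
  have r: "r < L" using L by (simp add: r_def)
  have fin: "finite B" using finite_signed_values[OF p p more(3)] by (simp add: B_def)
  have pos: "x \<ge> 1" if "x \<in> B" for x
    using signed_values_bounds[OF p p more(3)] that by (auto simp: B_def)
  have inj: "inj_on f B" "inj_on g B" using L by (auto simp: inj_on_def f_def g_def)
  have natf: "nat (f x) = nat x * L + r" if "x \<in> B" for x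
    using pos[OF that] by (simp add: f_def nat_add_distrib nat_mult_distrib mult.commute)
  have natg: "nat (g x) = nat x * L - r" if "x \<in> B" for x
    using pos[OF that] by (simp add: g_def nat_diff_distrib' nat_mult_distrib mult.commute)
  have "(\<Sum>x\<in>signed_values (enat L) p n. centred_jump (enat L) p (nat x) m) =
      (\<Sum>x\<in>B. of_bool (m mod L = r) * centred_jump p p (nat x) (m div L))"
  proof (cases "r = 0")
    case True
    hence "f ` B \<union> g ` B = f ` B" by (simp add: f_def g_def)
    hence "(\<Sum>x\<in>signed_values (enat L) p n. centred_jump (enat L) p (nat x) m) =
        (\<Sum>x\<in>B. centred_jump (enat L) p (nat (f x)) m)"
      by (simp add: A sum.reindex[OF inj(1)])
    also have "\<dots> = (\<Sum>x\<in>B. of_bool (m mod L = r) * centred_jump p p (nat x) (m div L))"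
    proof (rule sum.cong)
      fix x assume x: "x \<in> B"
      have "nat x \<ge> 1" using pos[OF x] by simp
      thus "centred_jump (enat L) p (nat (f x)) m =
          of_bool (m mod L = r) * centred_jump p p (nat x) (m div L)"
        using natf[OF x] centred_jump_multiple[OF L p] True by simp
    qed simp
    finally show ?thesis .
  next
    case False
    have "f x \<noteq> g y" if "x \<in> B" "y \<in> B" for x y
    proof
      assume "f x = g y"
      hence eq: "int L * (y - x) = 2 * int r" by (simp add: f_def g_def algebra_simps)
      have "0 < int L * (y - x)" "int L * (y - x) < int L * 2"
        unfolding eq using False r by simp_all
      hence "0 < y - x" "y - x < 2"
        using L by (simp_all add: zero_less_mult_iff)
      hence "y - x = 1" by simp
      moreover have "even (x - int (n div L))" "even (y - int (n div L))"
        using signed_values_parity[OF p p more(3)] that by (auto simp: B_def)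
      hence "even (y - int (n div L) - (x - int (n div L)))" by (rule dvd_diff[rotated])
      hence "even (y - x)" by simp
      ultimately show False by simp
    qed
    hence disj: "f ` B \<inter> g ` B = {}" by blast
    have "(\<Sum>x\<in>signed_values (enat L) p n. centred_jump (enat L) p (nat x) m) =
        (\<Sum>x\<in>B. centred_jump (enat L) p (nat (f x)) m + centred_jump (enat L) p (nat (g x)) m)"
      unfolding A using fin disj
      by (simp add: sum.union_disjoint sum.reindex[OF inj(1)] sum.reindex[OF inj(2)] sum.distrib)
    also have "\<dots> = (\<Sum>x\<in>B. of_bool (m mod L = r) * centred_jump p p (nat x) (m div L))"
    proof (rule sum.cong)
      fix x assume x: "x \<in> B"
      have "nat x \<ge> 1" using pos[OF x] by simp
      thus "centred_jump (enat L) p (nat (f x)) m + centred_jump (enat L) p (nat (g x)) m =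
          of_bool (m mod L = r) * centred_jump p p (nat x) (m div L)"
        unfolding natf[OF x] natg[OF x] using False r by (intro centred_jump_fold L p) simp_all
    qed simp
    finally show ?thesis .
  qed
  also have "\<dots> = of_bool (m mod L = r) * of_bool (n div L = m div L)"
    using more.IH[of "m div L"] by (simp add: B_def flip: sum_distrib_left)
  also have "\<dots> = of_bool (n = m)"
  proof -
    have "n = m \<longleftrightarrow> m mod L = n mod L \<and> n div L = m div L" by (metis div_mult_mod_eq)
    thus ?thesis by (auto simp: r_def)
  qed
  finally show ?case .
qed

lemma dtilde_eq_0:
  assumes "l \<ge> 2" "p \<ge> 2" "n \<ge> 1" "m > n"
  shows "dtilde l p n m = 0"
  using signed_values_bounds[OF assms(1-3)] assms(3,4)
  by (auto simp: dtilde_eq_signed_values)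

lemma dtilde_diag:
  assumes "l \<ge> 2" "p \<ge> 2" "n \<ge> 1"
  shows "dtilde l p n n = 1"
  using self_in_signed_values[OF assms] assms(3) by (simp add: dtilde_eq_signed_values)

lemma etilde_eq_0:
  assumes "l \<ge> 2" "p \<ge> 2" "n \<ge> 1" "m > n"
  shows "etilde l p n m = 0"
  using assms by (simp add: etilde_eq_centred_jump centred_jump_eq_0)

lemma sum_dtilde_etilde:
  assumes "l \<ge> 2" "p \<ge> 2" "n \<ge> 1" "m \<ge> 1"
  shows "(\<Sum>k=1..n. dtilde l p n k * etilde l p k m) = (if n = m then 1 else 0)"
proof -
  let ?S = "signed_values l p n"
  have "(\<Sum>k=1..n. dtilde l p n k * etilde l p k m) =
      (\<Sum>k=1..n. if int k \<in> ?S then centred_jump l p k m else 0)"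
    using assms by (intro sum.cong) (simp_all add: dtilde_eq_signed_values etilde_eq_centred_jump)
  also have "\<dots> = (\<Sum>k\<in>{k\<in>{1..n}. int k \<in> ?S}. centred_jump l p k m)"
    by (rule sum.inter_filter[symmetric]) simp
  also have "\<dots> = (\<Sum>x\<in>?S. centred_jump l p (nat x) m)"
    using signed_values_bounds[OF assms(1-3)]
    by (intro sum.reindex_bij_witness[of _ nat int]) force+
  also have "\<dots> = (if n = m then 1 else 0)"
    by (simp add: row_times_column[OF assms(1-3)])
  finally show ?thesis .
qed


section \<open>Inverses of unitriangular matrices\<close>

lemma has_mat_prod_lower_triangular:
  assumes "\<And>n k. n \<ge> 1 \<Longrightarrow> k > n \<Longrightarrow> A n k = 0"
    and "\<And>n m. n \<ge> 1 \<Longrightarrow> m \<ge> 1 \<Longrightarrow> (\<Sum>k=1..n. A n k * B k m) = C n m"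
  shows "has_mat_prod A B C"
  unfolding has_mat_prod_def
proof (intro allI impI conjI)
  fix n m :: nat assume nm: "n \<ge> 1" "m \<ge> 1"
  have sub: "{k. k \<ge> 1 \<and> A n k * B k m \<noteq> 0} \<subseteq> {1..n}"
    using assms(1)[OF nm(1)] by (force simp: not_le[symmetric])
  thus "finite {k. k \<ge> 1 \<and> A n k * B k m \<noteq> 0}" by (rule finite_subset) simp
  have "(\<Sum>k | k \<ge> 1 \<and> A n k * B k m \<noteq> 0. A n k * B k m) = (\<Sum>k=1..n. A n k * B k m)"
    using sub by (intro sum.mono_neutral_left) auto
  thus "(\<Sum>k | k \<ge> 1 \<and> A n k * B k m \<noteq> 0. A n k * B k m) = C n m"
    using assms(2)[OF nm] by simp
qed

text \<open>If \<open>A B = 1\<close>, then \<open>A (B A - 1) = 0\<close>, and a unitriangular \<open>A\<close> can be cancelled by forward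
  substitution.\<close>

lemma unitriangular_left_inverse:
  fixes A B :: "nat \<Rightarrow> nat \<Rightarrow> 'b::comm_ring_1"
  assumes A0: "\<And>n k. n \<ge> 1 \<Longrightarrow> k > n \<Longrightarrow> A n k = 0"
    and A1: "\<And>n. n \<ge> 1 \<Longrightarrow> A n n = 1"
    and B0: "\<And>n k. n \<ge> 1 \<Longrightarrow> k > n \<Longrightarrow> B n k = 0"
    and AB: "\<And>n m. n \<ge> 1 \<Longrightarrow> m \<ge> 1 \<Longrightarrow> (\<Sum>k=1..n. A n k * B k m) = (if n = m then 1 else 0)"
    and "n \<ge> 1" "m \<ge> 1"
  shows "(\<Sum>k=1..n. B n k * A k m) = (if n = m then 1 else 0)"
  using \<open>n \<ge> 1\<close>
proof (induction n rule: less_induct)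
  case (less n)
  define G where "G = (\<lambda>i. \<Sum>k=1..i. B i k * A k m)"
  have G: "G i = (\<Sum>k=1..n. B i k * A k m)" if "i \<in> {1..n}" for i
    unfolding G_def using that B0 by (intro sum.mono_neutral_left) auto
  have "(\<Sum>i=1..n. A n i * G i) = (\<Sum>i=1..n. \<Sum>k=1..n. A n i * (B i k * A k m))"
    by (simp add: G sum_distrib_left)
  also have "\<dots> = (\<Sum>k=1..n. (\<Sum>i=1..n. A n i * B i k) * A k m)"
    by (subst sum.swap) (simp add: sum_distrib_right mult.assoc)
  also have "\<dots> = (\<Sum>k=1..n. if k = n then A k m else 0)"
  proof (rule sum.cong[OF refl])
    fix k assume "k \<in> {1..n}"
    hence "(\<Sum>i=1..n. A n i * B i k) = (if n = k then 1 else 0)"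
      using AB less.prems by simp
    thus "(\<Sum>i=1..n. A n i * B i k) * A k m = (if k = n then A k m else 0)" by simp
  qed
  also have "\<dots> = A n m" using less.prems by simp
  finally have AG: "(\<Sum>i=1..n. A n i * G i) = A n m" .
  have split: "{1..n} = insert n {1..<n}" using less.prems by auto
  have "(\<Sum>i=1..<n. A n i * G i) = (\<Sum>i=1..<n. if i = m then A n i else 0)"
    using less.IH by (intro sum.cong) (simp_all add: G_def)
  also have "\<dots> = (if m < n then A n m else 0)" using \<open>m \<ge> 1\<close> by simp
  finally have "A n m = G n + (if m < n then A n m else 0)"
    using AG unfolding split by (simp add: A1[OF less.prems])
  hence "G n = (if n = m then 1 else 0)"
    using A0[of n m] A1 less.prems by (cases m n rule: linorder_cases) simp_all
  thus ?case by (simp add: G_def)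
qed

theorem mat_inverse_etilde_dtilde:
  assumes "l \<ge> 2" "p \<ge> 2"
  shows "mat_inverse (etilde l p) (dtilde l p)"
  unfolding mat_inverse_def
proof
  show "has_mat_prod (dtilde l p) (etilde l p) (\<lambda>n m. if n = m then 1 else 0)"
    using assms by (intro has_mat_prod_lower_triangular dtilde_eq_0 sum_dtilde_etilde)
  show "has_mat_prod (etilde l p) (dtilde l p) (\<lambda>n m. if n = m then 1 else 0)"
  proof (rule has_mat_prod_lower_triangular)
    show "(\<Sum>k=1..n. etilde l p n k * dtilde l p k m) = (if n = m then 1 else 0)"
      if "n \<ge> 1" "m \<ge> 1" for n m
      using dtilde_eq_0[OF assms] dtilde_diag[OF assms] etilde_eq_0[OF assms]
        sum_dtilde_etilde[OF assms] that
      by (rule unitriangular_left_inverse)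
  qed (rule etilde_eq_0[OF assms])
qed


section \<open>Quantum order and characteristic of a field\<close>

lemma qorder_ge_2: "qorder (\<delta> :: 'a::field) \<ge> 2"
proof (cases "\<exists>k>0. qnum \<delta> k = 0")
  case True
  define k where "k = (LEAST k. k > 0 \<and> qnum \<delta> k = 0)"
  have "k > 0 \<and> qnum \<delta> k = 0"
    unfolding k_def by (rule LeastI_ex[OF True])
  moreover from this have "k \<noteq> 1" by auto
  ultimately have "k \<ge> 2" by linarith
  thus ?thesis using True by (simp add: qorder_def k_def numeral_eq_enat)
next
  case False
  hence "qorder \<delta> = \<infinity>" unfolding qorder_def by (rule if_not_P)
  thus ?thesis by simp
qed

lemma echar_ge_2: "echar TYPE('a::field) \<ge> 2"
proof -
  have "CHAR('a) \<noteq> 1" by simp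
  hence "CHAR('a) = 0 \<or> CHAR('a) \<ge> 2" by linarith
  thus ?thesis by (auto simp: echar_def numeral_eq_enat)
qed

theorem theorem9p2:
  fixes \<delta> :: "'a::field"
  shows "mat_inverse (etilde (qorder \<delta>) (echar TYPE('a))) (dtilde (qorder \<delta>) (echar TYPE('a)))"
  by (rule mat_inverse_etilde_dtilde[OF qorder_ge_2 echar_ge_2])

end
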